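(* Let $X$ be a random variable taking values in $[0,1]$ with mean $\mu=\mathbb{E}[X]\in(0,1)$ and let $X_1,X_2,\dots$ be i.i.d. samples of $X$. Let $\gamma>0$, let $n$ be a positive integer, and let $\widehat{\mu}$ be the truncated inverse sampling estimator with threshold $\gamma$ and maximum sample size $n$. Let $0<\delta<1$. Define the lower confidence limit $\underline{\mu}\in[0,\widehat{\mu}]$ such that $\underline{\mu}=0$ for $\widehat{\mu}=0$, $$\mathscr{M}_{\mathrm{B}}(\widehat{\mu},\underline{\mu})=\frac{\ln\frac{\delta}{2}}{n}\ \text{ for }0<\widehat{\mu}<\frac{\gamma}{n},\qquad \mathscr{M}_{\mathrm{I}}(\widehat{\mu},\underline{\mu})=\frac{\ln\frac{\delta}{2}}{\gamma}\ \text{ for }\widehat{\mu}\ge\frac{\gamma}{n}.$$ Define the upper confidence limit $\overline{\mu}\in[\widehat{\mu},1]$ (the cases being read in the order listed) such that $\overline{\mu}=1$ for $\widehat{\mu}\ge\frac{\gamma}{\gamma+1}$, $$\mathscr{M}_{\mathrm{B}}(\widehat{\mu},\overline{\mu})=\frac{\ln\frac{\delta}{2}}{n}\ \text{ for }\widehat{\mu}<\frac{\gamma}{n},$$ and $$\mathscr{M}_{\mathrm{I}}\left(\frac{\widehat{\mu}\gamma}{\gamma-\widehat{\mu}},\overline{\mu}\right)=\frac{\ln\frac{\delta}{2}}{\gamma}\ \text{ and }\ \frac{\widehat{\mu}\gamma}{\gamma-\widehat{\mu}}<\overline{\mu}<1\ \text{ for }\frac{\gamma}{\gamma+1}>\widehat{\mu}\ge\frac{\gamma}{n}.$$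 Then $\Pr\{\underline{\mu}<\mu<\overline{\mu}\}\ge1-\delta$.
   Context: Truncated inverse sampling with threshold $\gamma>0$ and maximum sample size $n$: the (random) number of samples is $\mathbf{n}=\min\{n,\ \min\{\ell\in\mathbb{N}:\sum_{i=1}^{\ell}X_i\ge\gamma\}\}$ (minimum of the empty set is $+\infty$), $\mathbf{k}=\sum_{i=1}^{\mathbf{n}}X_i$, and the estimator is $\widehat{\mu}=\min\{\mathbf{k},\gamma\}/\mathbf{n}$. For $0<z<1$ and $0<\mu<1$, $$\mathscr{M}_{\mathrm{B}}(z,\mu)=z\ln\left(\frac{\mu}{z}\right)+(1-z)\ln\left(\frac{1-\mu}{1-z}\right),\qquad \mathscr{M}_{\mathrm{I}}(z,\mu)=\frac1z\mathscr{M}_{\mathrm{B}}(z,\mu),$$ extended by continuity in $z$: $\mathscr{M}_{\mathrm{B}}(0,\mu)=\ln(1-\mu)$ and $\mathscr{M}_{\mathrm{B}}(1,\mu)=\mathscr{M}_{\mathrm{I}}(1,\mu)=\ln\mu$. The limits $\underline{\mu},\overline{\mu}$ are random variables, being functions of $\widehat{\mu}$. *)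

theory Defs
  imports "HOL-Probability.Probability"
begin

text \<open>
  Only parameters \<open>0 < \<mu> < 1\<close> and arguments \<open>0 \<le> z \<le> 1\<close> are meaningful; the values at
  \<open>z = 0\<close> and \<open>z = 1\<close> are the continuous extensions in \<open>z\<close>.
\<close>
definition MB :: "real \<Rightarrow> real \<Rightarrow> real" where
  "MB z \<mu> =
     (if z = 0 then ln (1 - \<mu>)
      else if z = 1 then ln \<mu>
      else z * ln (\<mu> / z) + (1 - z) * ln ((1 - \<mu>) / (1 - z)))"

text \<open>Used only for \<open>0 < z \<le> 1\<close>; at \<open>z = 1\<close> this is \<open>ln \<mu>\<close>.\<close>
definition MI :: "real \<Rightarrow> real \<Rightarrow> real" where
  "MI z \<mu> = (1 / z) * MB z \<mu>"

text \<open>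
  Sample paths \<open>x\<close> are indexed from 1; \<open>x 0\<close> is never used. Inserting \<open>n\<close> before taking the
  minimum implements \<open>min {n, min A}\<close> with \<open>min {} = \<infinity>\<close>.
\<close>
definition sample_number :: "real \<Rightarrow> nat \<Rightarrow> (nat \<Rightarrow> real) \<Rightarrow> nat" where
  "sample_number \<gamma> n x = Inf (insert n {l. 1 \<le> l \<and> \<gamma> \<le> (\<Sum>i=1..l. x i)})"

definition mu_hat :: "real \<Rightarrow> nat \<Rightarrow> (nat \<Rightarrow> real) \<Rightarrow> real" where
  "mu_hat \<gamma> n x =
     min (\<Sum>i=1..sample_number \<gamma> n x. x i) \<gamma> / real (sample_number \<gamma> n x)"

text \<open>
  The confidence limits are given by defining conditions on their value at a value \<open>z\<close> of
  the estimator. An equation for \<open>MB\<close> or \<open>MI\<close> presupposes that its parameter lies in the open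
  unit interval, where these functions are defined; this is made explicit. For every
  \<open>0 \<le> z \<le> 1\<close> (with \<open>\<gamma> > 0\<close>, \<open>n \<ge> 1\<close>, \<open>0 < \<delta> < 1\<close>) exactly one number satisfies the
  condition, since \<open>MB z\<close> is strictly monotone on either side of \<open>z\<close> and continuous, is 0 in
  the limit at \<open>z\<close>, and tends to minus infinity at 0 (for \<open>z > 0\<close>) and at 1 (for \<open>z < 1\<close>).
\<close>
definition is_lower_limit :: "real \<Rightarrow> nat \<Rightarrow> real \<Rightarrow> real \<Rightarrow> real \<Rightarrow> bool" where
  "is_lower_limit \<gamma> n \<delta> z l \<longleftrightarrow>
     l \<in> {0..z} \<and>
     (z = 0 \<longrightarrow> l = 0) \<and>
     (0 < z \<and> z < \<gamma> / real n \<longrightarrow> 0 < l \<and> l < 1 \<and> MB z l = ln (\<delta> / 2) / real n) \<and>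
     (\<gamma> / real n \<le> z \<longrightarrow> 0 < l \<and> l < 1 \<and> MI z l = ln (\<delta> / 2) / \<gamma>)"

text \<open>
  The conditional makes the first applicable case decisive: the first two overlap when
  \<open>n < \<gamma> + 1\<close>.
\<close>
definition is_upper_limit :: "real \<Rightarrow> nat \<Rightarrow> real \<Rightarrow> real \<Rightarrow> real \<Rightarrow> bool" where
  "is_upper_limit \<gamma> n \<delta> z u \<longleftrightarrow>
     u \<in> {z..1} \<and>
     (if \<gamma> / (\<gamma> + 1) \<le> z then u = 1
      else if z < \<gamma> / real n then 0 < u \<and> u < 1 \<and> MB z u = ln (\<delta> / 2) / real n
      else MI (z * \<gamma> / (\<gamma> - z)) u = ln (\<delta> / 2) / \<gamma> \<and> z * \<gamma> / (\<gamma> - z) < u \<and> u < 1)"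

definition lower_limit :: "real \<Rightarrow> nat \<Rightarrow> real \<Rightarrow> real \<Rightarrow> real" where
  "lower_limit \<gamma> n \<delta> z = (THE l. is_lower_limit \<gamma> n \<delta> z l)"

definition upper_limit :: "real \<Rightarrow> nat \<Rightarrow> real \<Rightarrow> real \<Rightarrow> real" where
  "upper_limit \<gamma> n \<delta> z = (THE u. is_upper_limit \<gamma> n \<delta> z u)"

end

theory Submission
  imports Defs
begin

text \<open>
  Let \<open>S m = X 1 + ... + X m\<close> and order the outcomes by the value \<open>Z\<close> of the estimator. If \<open>z < \<gamma> / n\<close>, then \<open>Z \<ge> z\<close> forces
  \<open>S n \<ge> n z\<close> and \<open>Z \<le> z\<close> forces \<open>S n \<le> n z\<close>; if \<open>z = \<gamma> / m\<close> is attained by stopping at time \<open>m\<close>,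
  then \<open>Z \<ge> z\<close> forces \<open>S m \<ge> \<gamma>\<close> and \<open>Z \<le> z\<close> forces \<open>S (m - 1) \<le> \<gamma>\<close>, because partial sums
  increase. So each one-sided tail of \<open>Z\<close> is bounded by a Chernoff bound at a single deterministic
  time, and a lower limit above \<open>\<mu>\<close> (respectively an upper limit below \<open>\<mu>\<close>) implies that the tail
  probability at the observed value of \<open>Z\<close> is at most \<open>\<delta> / 2\<close>. A random variable lands with
  probability at most \<open>c\<close> in the set of values at which its own tail function is at most \<open>c\<close>.
\<close>

section \<open>The function \<open>MB\<close>: monotonicity in the parameter and solvability of
  \<open>MB z p = c\<close>\<close>

text \<open>At \<open>z = 0\<close> and \<open>z = 1\<close> the summand that divides by zero
  carries the factor 0, so the interior formula also yields the continuous extensions. Continuity in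
  the parameter and measurability in \<open>z\<close> can then be shown without a case
  split.\<close>

lemma MB_eq: "MB z p = z * ln (p / z) + (1 - z) * ln ((1 - p) / (1 - z))"
  by (simp add: MB_def)

lemma MB_expand:
  assumes "0 \<le> z" "z \<le> 1" "0 < p" "p < 1"
  shows "MB z p = z * ln p + (1 - z) * ln (1 - p) - (z * ln z + (1 - z) * ln (1 - z))"
proof (cases "z = 0 \<or> z = 1")
  case False
  then show ?thesis
    using assms by (simp add: MB_eq ln_div algebra_simps)
qed (auto simp: MB_def)

text \<open>The reflection of samples to \<open>1 - X\<close>: it carries results on parameters
  below \<open>z\<close>, and on lower tails, over to the opposite side.\<close>

lemma MB_flip: "MB (1 - z) (1 - p) = MB z p"
  by (simp add: MB_eq)

lemma MB_self: "0 \<le> z \<Longrightarrow> z \<le> 1 \<Longrightarrow> MB z z = 0"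
  by (auto simp: MB_def)

text \<open>Applying \<open>ln x \<le> x - 1\<close> to \<open>p / q\<close> and to
  \<open>(1 - p) / (1 - q)\<close> bounds \<open>MB z p - MB z q\<close> by
  \<open>- (z - q) * (q - p) / (q * (1 - q))\<close>, which is at most 0. Strictness comes from the
  first ratio, which differs from 1.\<close>

lemma MB_strict_mono:
  assumes z: "z \<le> 1" and p: "0 < p" "p < q" "q \<le> z" and q: "q < 1"
  shows "MB z p < MB z q"
proof (cases "z = 1")
  case True
  then show ?thesis using p q by (simp add: MB_def)
next
  case False
  have "0 < z * ((q - p) / q) - (1 - z) * ((q - p) / (1 - q)) \<or> z = q"
  proof (cases "z = q")
    case False
    then have "q < z" using p by simp
    then have "0 < (z - q) * (q - p) / (q * (1 - q))" using p q by (intro divide_pos_pos mult_pos_pos) auto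
    also have "\<dots> = z * ((q - p) / q) - (1 - z) * ((q - p) / (1 - q))"
      using p q by (simp add: field_simps)
    finally show ?thesis by simp
  qed simp
  then have key: "0 \<le> z * ((q - p) / q) - (1 - z) * ((q - p) / (1 - q))"
    using p q by auto
  have lt: "ln x < x - 1" if "x > 0" "x \<noteq> 1" for x :: real
    using that ln_le_minus_one[of x] ln_eq_minus_one[of x] by fastforce
  have 1: "ln (p / q) < p / q - 1" using p by (intro lt) auto
  have 2: "ln ((1 - p) / (1 - q)) \<le> (1 - p) / (1 - q) - 1"
    using p q by (intro ln_le_minus_one) auto
  have "z * ln (p / q) + (1 - z) * ln ((1 - p) / (1 - q)) <
        z * (p / q - 1) + (1 - z) * ((1 - p) / (1 - q) - 1)"
    using 1 2 z p by (intro add_less_le_mono mult_strict_left_mono mult_left_mono) auto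
  also have "\<dots> = - (z * ((q - p) / q) - (1 - z) * ((q - p) / (1 - q)))"
    using p q by (simp add: field_simps)
  also have "\<dots> \<le> 0" using key by simp
  finally have "z * (ln p - ln q) + (1 - z) * (ln (1 - p) - ln (1 - q)) < 0"
    using p q by (simp add: ln_div)
  then show ?thesis
    using p q z by (simp add: MB_expand algebra_simps)
qed

lemma MB_le_iff:
  assumes "z \<le> 1" "0 < p" "p \<le> z" "p < 1" "0 < q" "q \<le> z" "q < 1"
  shows "MB z p \<le> MB z q \<longleftrightarrow> p \<le> q"
  using MB_strict_mono[of z p q] MB_strict_mono[of z q p] assms
  by (cases p q rule: linorder_cases) auto

lemma ex1_MB_lower:
  assumes z: "0 < z" "z \<le> 1" and c: "c < 0"
  shows "\<exists>!l. 0 < l \<and> l < 1 \<and> l \<le> z \<and> MB z l = c"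
proof (rule ex_ex1I)
  show "\<exists>l. 0 < l \<and> l < 1 \<and> l \<le> z \<and> MB z l = c"
  proof (cases "z = 1")
    case True
    then show ?thesis using c by (intro exI[of _ "exp c"]) (auto simp: MB_def)
  next
    case False
    then have z1: "z < 1" using z by simp
    define H where "H = z * ln z + (1 - z) * ln (1 - z)"
    \<comment> \<open>Left end point for the intermediate value theorem. As
      \<open>(1 - z) * ln (1 - e)\<close> is nonpositive, \<open>MB z e \<le> c\<close> follows from
      \<open>z * ln e \<le> c + H\<close>; solving for \<open>e\<close> gives the exponential, and
      the minimum keeps \<open>e\<close> below \<open>z\<close>.\<close>
    define e where "e = min z (exp ((c + H) / z))"
    have e: "0 < e" "e \<le> z" using z by (auto simp: e_def)
    have "ln e \<le> (c + H) / z"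
      using e z by (metis e_def exp_gt_zero ln_exp ln_mono min.cobounded2)
    then have "z * ln e \<le> c + H" using z by (simp add: field_simps)
    moreover have "(1 - z) * ln (1 - e) \<le> 0"
      using e z z1 by (intro mult_nonneg_nonpos) auto
    ultimately have "MB z e \<le> c" using e z z1 by (simp add: MB_expand H_def)
    moreover have "c \<le> MB z z" using z c by (simp add: MB_self)
    moreover have "continuous_on {e..z} (MB z)"
      unfolding MB_eq using e z z1 by (intro continuous_intros) auto
    ultimately obtain l where "e \<le> l" "l \<le> z" "MB z l = c"
      using IVT'[of "MB z" e c z] e by auto
    then show ?thesis using e z1 by (intro exI[of _ l]) auto
  qed
next
  fix l l' assume "0 < l \<and> l < 1 \<and> l \<le> z \<and> MB z l = c" "0 < l' \<and> l' < 1 \<and> l' \<le> z \<and> MB z l' = c"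
  then show "l = l'" using MB_le_iff[of z l l'] MB_le_iff[of z l' l] z by simp
qed

lemma ex1_MB_upper:
  assumes "0 \<le> z" "z < 1" "c < 0"
  shows "\<exists>!u. 0 < u \<and> u < 1 \<and> z \<le> u \<and> MB z u = c"
proof -
  have "\<exists>!l. 0 < l \<and> l < 1 \<and> l \<le> 1 - z \<and> MB (1 - z) l = c"
    using assms by (intro ex1_MB_lower) auto
  then obtain l where l: "0 < l" "l < 1" "l \<le> 1 - z" "MB (1 - z) l = c"
    and uniq: "\<And>l'. 0 < l' \<Longrightarrow> l' < 1 \<Longrightarrow> l' \<le> 1 - z \<Longrightarrow> MB (1 - z) l' = c \<Longrightarrow> l' = l"
    by blast
  show ?thesis
  proof (rule ex1I[of _ "1 - l"])
    show "0 < 1 - l \<and> 1 - l < 1 \<and> z \<le> 1 - l \<and> MB z (1 - l) = c"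
      using l MB_flip[of z "1 - l"] by auto
  next
    fix u assume u: "0 < u \<and> u < 1 \<and> z \<le> u \<and> MB z u = c"
    then have "1 - u = l" using MB_flip[of z u] by (intro uniq) auto
    then show "u = 1 - l" by simp
  qed
qed

section \<open>Confidence limits: existence, uniqueness, and elimination from inequalities\<close>

lemma MI_eq_iff: "0 < z \<Longrightarrow> MI z p = c \<longleftrightarrow> MB z p = z * c"
  by (auto simp: MI_def field_simps)

lemma is_lower_limit_lower_limit:
  assumes "0 \<le> z" "z \<le> 1" "0 < \<gamma>" "1 \<le> n" "0 < \<delta>" "\<delta> < 1"
  shows "is_lower_limit \<gamma> n \<delta> z (lower_limit \<gamma> n \<delta> z)"
proof -
  have b: "ln (\<delta> / 2) < 0" using assms by simp
  have gn: "0 < \<gamma> / n" using assms by simp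
  have "\<exists>!l. is_lower_limit \<gamma> n \<delta> z l"
  proof (cases "z = 0")
    case True
    then have "is_lower_limit \<gamma> n \<delta> z = (\<lambda>l. l = 0)"
      using gn by (intro ext) (auto simp: is_lower_limit_def)
    then show ?thesis by simp
  next
    case False
    \<comment> \<open>Multiplying the \<open>MI\<close> equation by \<open>z\<close> puts both
      regimes into the single form \<open>MB z l = c\<close> with a negative
      \<open>c\<close>.\<close>
    define c where "c = (if z < \<gamma> / n then ln (\<delta> / 2) / n else z * (ln (\<delta> / 2) / \<gamma>))"
    have "c < 0" using b assms False
      by (auto simp: c_def intro!: divide_neg_pos mult_pos_neg)
    moreover have "is_lower_limit \<gamma> n \<delta> z = (\<lambda>l. 0 < l \<and> l < 1 \<and> l \<le> z \<and> MB z l = c)"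
      using False assms by (intro ext) (auto simp: is_lower_limit_def c_def MI_eq_iff)
    ultimately show ?thesis using ex1_MB_lower[of z c] assms False by simp
  qed
  then show ?thesis unfolding lower_limit_def by (rule theI')
qed

text \<open>For \<open>z = \<gamma> / m\<close> the shifted value is
  \<open>\<gamma> / (m - 1)\<close>, the average one sample before stopping when the sum is
  \<open>\<gamma>\<close>. The bound on \<open>z\<close> means \<open>m > \<gamma> + 1\<close>,
  which is what keeps this average below 1.\<close>

lemma odds_shift:
  fixes z \<gamma> :: real
  assumes "0 \<le> z" "z < \<gamma> / (\<gamma> + 1)" "0 < \<gamma>"
  shows "z < \<gamma>" "z < 1" "z \<le> z * \<gamma> / (\<gamma> - z)" "z * \<gamma> / (\<gamma> - z) < 1"
    and "0 < z \<Longrightarrow> 0 < z * \<gamma> / (\<gamma> - z)"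
proof -
  have *: "z * \<gamma> + z < \<gamma>" using assms by (simp add: field_simps)
  have "0 \<le> z * \<gamma>" using assms by simp
  then show zg: "z < \<gamma>" using * by linarith
  have "z * (\<gamma> + 1) < 1 * (\<gamma> + 1)" using * by (simp add: algebra_simps)
  then show "z < 1" by (rule mult_right_less_imp_less) (use assms in simp)
  show "z \<le> z * \<gamma> / (\<gamma> - z)" "z * \<gamma> / (\<gamma> - z) < 1"
    using zg assms * by (auto simp: field_simps)
  show "0 < z * \<gamma> / (\<gamma> - z)" if "0 < z" using that zg assms by simp
qed

lemma is_upper_limit_upper_limit:
  assumes "0 \<le> z" "z \<le> 1" "0 < \<gamma>" "1 \<le> n" "0 < \<delta>" "\<delta> < 1"
  shows "is_upper_limit \<gamma> n \<delta> z (upper_limit \<gamma> n \<delta> z)"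
proof -
  have b: "ln (\<delta> / 2) < 0" using assms by simp
  have gn: "0 < \<gamma> / n" using assms by simp
  have "\<exists>!u. is_upper_limit \<gamma> n \<delta> z u"
  proof (cases "\<gamma> / (\<gamma> + 1) \<le> z")
    case True
    then have "is_upper_limit \<gamma> n \<delta> z = (\<lambda>u. u = 1)"
      using assms by (intro ext) (auto simp: is_upper_limit_def)
    then show ?thesis by simp
  next
    case False
    note os = odds_shift[of z \<gamma>]
    show ?thesis
    proof (cases "z < \<gamma> / n")
      case True
      have "is_upper_limit \<gamma> n \<delta> z = (\<lambda>u. 0 < u \<and> u < 1 \<and> z \<le> u \<and> MB z u = ln (\<delta> / 2) / n)"
        using True False by (intro ext) (auto simp: is_upper_limit_def)
      moreover have "ln (\<delta> / 2) / n < 0" using b assms by (simp add: divide_neg_pos)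
      ultimately show ?thesis using ex1_MB_upper[of z "ln (\<delta> / 2) / n"] False os assms by simp
    next
      case zn: False
      define y where "y = z * \<gamma> / (\<gamma> - z)"
      have z: "0 < z" using zn gn by linarith
      have y: "z \<le> y" "y < 1" "0 < y"
        using odds_shift[of z \<gamma>] False assms z by (auto simp: y_def)
      define c where "c = y * (ln (\<delta> / 2) / \<gamma>)"
      have neg: "c < 0"
        unfolding c_def using b assms y by (intro mult_pos_neg divide_neg_pos) auto
      \<comment> \<open>The definition asks for \<open>y < u\<close>, whereas
        \<open>ex1_MB_upper\<close> works with \<open>y \<le> u\<close>. The value
        \<open>u = y\<close> is no solution because \<open>MB y y = 0\<close> and \<open>c\<close>
        is negative.\<close>
      have ne: "MB y y \<noteq> c" using y neg MB_self[of y] by simp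
      have "is_upper_limit \<gamma> n \<delta> z u \<longleftrightarrow> u \<in> {z..1} \<and> MB y u = c \<and> y < u \<and> u < 1" for u
        using zn False MI_eq_iff[OF y(3)]
        by (simp add: is_upper_limit_def y_def[symmetric] c_def)
      moreover have "u \<in> {z..1} \<and> MB y u = c \<and> y < u \<and> u < 1 \<longleftrightarrow>
          0 < u \<and> u < 1 \<and> y \<le> u \<and> MB y u = c" for u
      proof (cases "u = y")
        case True
        then show ?thesis using ne by blast
      next
        case False
        then show ?thesis using y by auto
      qed
      ultimately have "is_upper_limit \<gamma> n \<delta> z u \<longleftrightarrow> 0 < u \<and> u < 1 \<and> y \<le> u \<and> MB y u = c" for u
        by (rule trans)
      then show ?thesis using ex1_MB_upper[OF _ y(2) neg] y by simp
    qed
  qed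
  then show ?thesis unfolding upper_limit_def by (rule theI')
qed

text \<open>Since \<open>MB z\<close> increases on parameters up to \<open>z\<close>, comparing
  \<open>p\<close> with the limit amounts to comparing \<open>MB z p\<close> with the prescribed
  value. The right-hand side no longer mentions the limit and bounds exactly the exponent of a
  Chernoff bound.\<close>

lemma lower_limit_ge_iff:
  assumes "0 \<le> z" "z \<le> 1" "0 < \<gamma>" "1 \<le> n" "0 < \<delta>" "\<delta> < 1" and p: "0 < p" "p < 1"
  shows "p \<le> lower_limit \<gamma> n \<delta> z \<longleftrightarrow>
    p \<le> z \<and> (if z < \<gamma> / n then MB z p \<le> ln (\<delta> / 2) / n else MI z p \<le> ln (\<delta> / 2) / \<gamma>)"
proof -
  define l where "l = lower_limit \<gamma> n \<delta> z"
  have l: "is_lower_limit \<gamma> n \<delta> z l"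
    unfolding l_def using assms by (intro is_lower_limit_lower_limit)
  show ?thesis
  proof (cases "p \<le> z")
    case False
    then show ?thesis using l unfolding l_def[symmetric] by (auto simp: is_lower_limit_def)
  next
    case True
    then have z: "0 < z" using p by simp
    then have l': "0 < l" "l < 1" "l \<le> z"
      using l by (auto simp: is_lower_limit_def not_less[symmetric])
    have "p \<le> l \<longleftrightarrow> MB z p \<le> MB z l" using MB_le_iff[of z p l] True l' p assms by simp
    moreover have "MI z p \<le> MI z l \<longleftrightarrow> MB z p \<le> MB z l"
      using z by (simp add: MI_def divide_le_cancel)
    ultimately show ?thesis
      using l True z unfolding l_def[symmetric] by (auto simp: is_lower_limit_def)
  qed
qed

lemma upper_limit_le_iff:
  assumes "0 \<le> z" "z \<le> 1" "0 < \<gamma>" "1 \<le> n" "0 < \<delta>" "\<delta> < 1" and p: "0 < p" "p < 1"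
  shows "upper_limit \<gamma> n \<delta> z \<le> p \<longleftrightarrow>
    z < \<gamma> / (\<gamma> + 1) \<and>
    (if z < \<gamma> / n then z \<le> p \<and> MB z p \<le> ln (\<delta> / 2) / n
     else z * \<gamma> / (\<gamma> - z) \<le> p \<and> MI (z * \<gamma> / (\<gamma> - z)) p \<le> ln (\<delta> / 2) / \<gamma>)"
proof -
  define u where "u = upper_limit \<gamma> n \<delta> z"
  have u: "is_upper_limit \<gamma> n \<delta> z u"
    unfolding u_def using assms by (intro is_upper_limit_upper_limit)
  \<comment> \<open>Reflection moves parameters above \<open>y\<close> to parameters below
    \<open>1 - y\<close> and reverses their order.\<close>
  have mono: "MB y p \<le> MB y u \<longleftrightarrow> u \<le> p" if "0 \<le> y" "y \<le> p" "y \<le> u" "0 < u" "u < 1" for y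
    using MB_le_iff[of "1 - y" "1 - p" "1 - u"] that p by (simp add: MB_flip)
  have gn: "0 < \<gamma> / n" using assms by simp
  show ?thesis
  proof (cases "\<gamma> / (\<gamma> + 1) \<le> z")
    case True
    then show ?thesis using u p unfolding u_def[symmetric] by (auto simp: is_upper_limit_def)
  next
    case zg: False
    show ?thesis
    proof (cases "z < \<gamma> / n")
      case True
      then show ?thesis using u zg mono[of z] assms
        unfolding u_def[symmetric] by (auto simp: is_upper_limit_def)
    next
      case False
      define y where "y = z * \<gamma> / (\<gamma> - z)"
      have y: "0 < y"
        unfolding y_def by (rule odds_shift) (use False gn zg assms in linarith)+
      have u': "MI y u = ln (\<delta> / 2) / \<gamma>" "y < u" "u < 1"
        using u zg False by (auto simp: is_upper_limit_def y_def)
      have "MI y p \<le> MI y u \<longleftrightarrow> MB y p \<le> MB y u"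
        using y by (simp add: MI_def divide_le_cancel)
      then have "u \<le> p \<longleftrightarrow> y \<le> p \<and> MI y p \<le> ln (\<delta> / 2) / \<gamma>"
        using u' mono[of y] y by auto
      then show ?thesis
        using zg False unfolding u_def[symmetric] y_def[symmetric] by simp
    qed
  qed
qed


section \<open>The estimator along a single sample path\<close>

text \<open>The two cases are separated by the position of the estimator relative to
  \<open>\<gamma> / n\<close>. Reaching the threshold exactly at time \<open>n\<close> counts as
  stopped with \<open>m = n\<close>. Samples are at most 1, so stopping at \<open>m\<close> forces
  \<open>\<gamma> \<le> m\<close>, which keeps the estimator at most 1.\<close>

lemma mu_hat_cases:
  assumes x: "x \<in> {1..} \<rightarrow> {0..1}" and "0 < \<gamma>" "1 \<le> n"
  obtains
    (truncated) "(\<Sum>i=1..n. x i) < \<gamma>" "mu_hat \<gamma> n x = (\<Sum>i=1..n. x i) / n" "mu_hat \<gamma> n x < \<gamma> / n"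
  | (stopped) m where "1 \<le> m" "m \<le> n" "\<gamma> \<le> m" "\<gamma> \<le> (\<Sum>i=1..m. x i)"
      "\<And>l. 1 \<le> l \<Longrightarrow> \<gamma> \<le> (\<Sum>i=1..l. x i) \<Longrightarrow> m \<le> l"
      "mu_hat \<gamma> n x = \<gamma> / m" "\<gamma> / n \<le> mu_hat \<gamma> n x"
proof -
  define A where "A = {l. 1 \<le> l \<and> \<gamma> \<le> (\<Sum>i=1..l. x i)}"
  define m where "m = sample_number \<gamma> n x"
  have m: "m = Inf (insert n A)" by (simp add: m_def sample_number_def A_def)
  have mem: "m \<in> insert n A" unfolding m by (rule wellorder_InfI[of n]) simp
  have le: "m \<le> l" if "l \<in> insert n A" for l unfolding m by (rule wellorder_Inf_le1[OF that])
  have m1: "1 \<le> m" using mem assms by (auto simp: A_def)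
  have hat: "mu_hat \<gamma> n x = min (\<Sum>i=1..m. x i) \<gamma> / m" by (simp add: mu_hat_def m_def)
  show ?thesis
  proof (cases "m \<in> A")
    case True
    then have ge: "\<gamma> \<le> (\<Sum>i=1..m. x i)" by (simp add: A_def)
    have "(\<Sum>i=1..m. x i) \<le> (\<Sum>i=1..m. 1)" using x by (intro sum_mono) (auto simp: Pi_iff)
    then have "\<gamma> \<le> m" using ge by simp
    moreover have "m \<le> n" using le by simp
    moreover have "m \<le> l" if "1 \<le> l" "\<gamma> \<le> (\<Sum>i=1..l. x i)" for l
      using le[of l] that by (simp add: A_def)
    ultimately show ?thesis using stopped[of m] m1 ge hat assms by (simp add: frac_le)
  next
    case False
    then have "m = n" using mem by simp
    then have "(\<Sum>i=1..n. x i) < \<gamma>" using False assms by (simp add: A_def)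
    then show ?thesis using truncated hat \<open>m = n\<close> assms by (simp add: divide_strict_right_mono)
  qed
qed

lemma mu_hat_bounds:
  assumes x: "x \<in> {1..} \<rightarrow> {0..1}" and "0 < \<gamma>" "1 \<le> n"
  shows "0 \<le> mu_hat \<gamma> n x" "mu_hat \<gamma> n x \<le> 1"
proof -
  have "0 \<le> (\<Sum>i=1..n. x i)"
    using x by (intro sum_nonneg) (auto simp: Pi_iff)
  moreover have "(\<Sum>i=1..n. x i) \<le> (\<Sum>i=1..n. 1)"
    using x by (intro sum_mono) (auto simp: Pi_iff)
  ultimately show "0 \<le> mu_hat \<gamma> n x" "mu_hat \<gamma> n x \<le> 1"
    by (cases rule: mu_hat_cases[OF assms]; use assms in simp)+
qed

lemma sum_unit_mono:
  fixes x :: "nat \<Rightarrow> real"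
  assumes "x \<in> {1..} \<rightarrow> {0..1}" "k \<le> l"
  shows "(\<Sum>i=1..k. x i) \<le> (\<Sum>i=1..l. x i)"
  using assms by (intro sum_mono2) (auto simp: Pi_iff)

lemma divide_const_le_iff:
  fixes c :: real and k m :: nat
  assumes "0 < c" "1 \<le> k" "1 \<le> m"
  shows "c / m \<le> c / k \<longleftrightarrow> k \<le> m"
  using assms by (simp add: frac_le_eq divide_le_0_iff field_simps)

text \<open>A path that stopped early is also covered: its sum at time \<open>n\<close> is still at
  least \<open>\<gamma>\<close>, hence at least \<open>n * z\<close>.\<close>

lemma truncated_le_mu_hat:
  assumes x: "x \<in> {1..} \<rightarrow> {0..1}" and "0 < \<gamma>" "1 \<le> n"
    and "z \<le> \<gamma> / n" "z \<le> mu_hat \<gamma> n x"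
  shows "n * z \<le> (\<Sum>i=1..n. x i)"
  using x \<open>0 < \<gamma>\<close> \<open>1 \<le> n\<close>
proof (cases rule: mu_hat_cases)
  case truncated
  then have "(\<Sum>i=1..n. x i) = n * mu_hat \<gamma> n x" using assms by simp
  then show ?thesis using assms by (simp add: mult_left_mono)
next
  case (stopped m)
  then have "\<gamma> \<le> (\<Sum>i=1..n. x i)" using sum_unit_mono[of x m n] x by auto
  moreover have "n * z \<le> \<gamma>" using assms by (simp add: field_simps)
  ultimately show ?thesis by simp
qed

text \<open>Stopped paths have estimator at least \<open>\<gamma> / n\<close> and so cannot occur;
  on the others the estimator is the average of all \<open>n\<close> samples.\<close>

lemma mu_hat_le_truncated:
  assumes x: "x \<in> {1..} \<rightarrow> {0..1}" and "0 < \<gamma>" "1 \<le> n"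
    and "z < \<gamma> / n" "mu_hat \<gamma> n x \<le> z"
  shows "(\<Sum>i=1..n. x i) \<le> n * z"
  using x \<open>0 < \<gamma>\<close> \<open>1 \<le> n\<close>
proof (cases rule: mu_hat_cases)
  case truncated
  then have "(\<Sum>i=1..n. x i) = n * mu_hat \<gamma> n x" using assms by simp
  then show ?thesis using assms by (simp add: mult_left_mono)
next
  case (stopped m)
  then show ?thesis using assms by simp
qed

text \<open>A truncated path has too small an estimator, and a path stopped at \<open>k\<close>
  satisfies \<open>k \<le> m\<close>, so its sum has reached the threshold by time
  \<open>m\<close>.\<close>

lemma stopped_le_mu_hat:
  assumes x: "x \<in> {1..} \<rightarrow> {0..1}" and "0 < \<gamma>" "1 \<le> n"
    and m: "1 \<le> m" "m \<le> n" "\<gamma> / m \<le> mu_hat \<gamma> n x"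
  shows "\<gamma> \<le> (\<Sum>i=1..m. x i)"
  using x \<open>0 < \<gamma>\<close> \<open>1 \<le> n\<close>
proof (cases rule: mu_hat_cases)
  case truncated
  have "\<gamma> / n \<le> \<gamma> / m" using assms by (intro divide_left_mono) auto
  then show ?thesis using truncated m by simp
next
  case (stopped k)
  then have "k \<le> m" using assms divide_const_le_iff[of \<gamma> k m] by simp
  then show ?thesis using stopped sum_unit_mono[of x k m] x by auto
qed

text \<open>If the sum exceeded \<open>\<gamma>\<close> at time \<open>m - 1\<close>, stopping would
  occur by then and the estimator would be larger than \<open>\<gamma> / m\<close>. Time
  \<open>m\<close> itself would not do, since the last sample may overshoot the threshold; this is
  the origin of the shifted argument in the upper limit.\<close>

lemma mu_hat_le_stopped:
  assumes x: "x \<in> {1..} \<rightarrow> {0..1}" and "0 < \<gamma>" "1 \<le> n"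
    and m: "1 < m" "m \<le> n" "mu_hat \<gamma> n x \<le> \<gamma> / m"
  shows "(\<Sum>i=1..m-1. x i) \<le> \<gamma>"
proof (rule ccontr)
  assume "\<not> ?thesis"
  then have gt: "\<gamma> < (\<Sum>i=1..m-1. x i)" by simp
  show False
    using x \<open>0 < \<gamma>\<close> \<open>1 \<le> n\<close>
  proof (cases rule: mu_hat_cases)
    case truncated
    moreover have "(\<Sum>i=1..m-1. x i) \<le> (\<Sum>i=1..n. x i)"
      using m by (intro sum_unit_mono[OF x]) auto
    ultimately show False using gt by linarith
  next
    case (stopped k)
    then have "k \<le> m - 1" using gt m by auto
    moreover have "m \<le> k" using stopped m assms divide_const_le_iff[of \<gamma> m k] by simp
    ultimately show False using m by simp
  qed
qed

section \<open>Chernoff bounds for sums of independent variables with values in the unit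
  interval\<close>

text \<open>Convexity of \<open>exp\<close> between 0 and \<open>ln a\<close>.\<close>

lemma powr_le_chord:
  fixes a y :: real
  assumes "0 < a" "0 \<le> y" "y \<le> 1"
  shows "a powr y \<le> 1 - y + y * a"
proof -
  have "exp ((1 - y) *\<^sub>R 0 + y *\<^sub>R ln a) \<le> (1 - y) * exp 0 + y * exp (ln a)"
    using assms by (intro convex_onD[OF exp_convex]) auto
  then show ?thesis using assms by (simp add: powr_def)
qed

context prob_space
begin

text \<open>
  The moment bound uses the chord \<open>1 - y + y a\<close> in place of \<open>a powr y\<close>, so that the optimal \<open>a = 0\<close>
  for \<open>z = 0\<close> needs no limit.
\<close>
lemma chernoff_unit_le:
  fixes Y :: "'i \<Rightarrow> 'a \<Rightarrow> real" and p z :: real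
  assumes I: "finite I" and ind: "indep_vars (\<lambda>_. borel) Y I"
    and Y: "\<And>i \<omega>. i \<in> I \<Longrightarrow> \<omega> \<in> space M \<Longrightarrow> Y i \<omega> \<in> {0..1}"
    and p: "\<And>i. i \<in> I \<Longrightarrow> expectation (Y i) = p" "0 < p" "p < 1"
    and z: "0 \<le> z" "z \<le> p"
  shows "prob {\<omega> \<in> space M. (\<Sum>i\<in>I. Y i \<omega>) \<le> card I * z} \<le> exp (card I * MB z p)"
proof -
  define n where "n = card I"
  \<comment> \<open>The optimal exponential tilt: the odds of \<open>z\<close> divided by the odds
    of \<open>p\<close>. It minimises \<open>(1 - p + p * a) / a powr z\<close> for
    \<open>0 < z\<close>, and it turns the numerator into \<open>(1 - p) / (1 - z)\<close>.\<close>
  define a where "a = z * (1 - p) / ((1 - z) * p)"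
  have a0: "0 \<le> a" using z p by (simp add: a_def)
  have "z * (1 - p) \<le> (1 - z) * p" using z by (simp add: algebra_simps)
  then have a1: "a \<le> 1" using z p by (simp add: a_def)
  have a_pos: "0 < a" if "z \<noteq> 0" using that z p by (simp add: a_def)
  define W where "W = (\<lambda>i \<omega>. 1 - Y i \<omega> + Y i \<omega> * a)"
  have [measurable]: "Y i \<in> borel_measurable M" if "i \<in> I" for i
    using ind that by (auto simp: indep_vars_def)
  have intY: "integrable M (Y i)" if "i \<in> I" for i
    using that Y by (intro integrable_const_bound[of _ 1]) (auto intro!: AE_I2)
  have indW: "indep_vars (\<lambda>_. borel) W I"
    unfolding W_def by (rule indep_vars_compose2[OF ind, of "\<lambda>i y. 1 - y + y * a"]) simp
  have intW: "integrable M (W i)" if "i \<in> I" for i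
    unfolding W_def using intY[OF that] by simp
  have EW: "expectation (W i) = (1 - p) / (1 - z)" if "i \<in> I" for i
  proof -
    have "expectation (W i) = 1 - p + p * a"
      unfolding W_def using intY[OF that] p that by (simp add: prob_space)
    also have "\<dots> = (1 - p) / (1 - z)"
      using z p by (simp add: a_def field_simps)
    finally show ?thesis .
  qed
  have W0: "0 \<le> W i \<omega>" if "i \<in> I" "\<omega> \<in> space M" for i \<omega>
    using Y[OF that] a0 by (simp add: W_def)
  have EP: "expectation (\<lambda>\<omega>. \<Prod>i\<in>I. W i \<omega>) = ((1 - p) / (1 - z)) ^ n"
    using indep_vars_lebesgue_integral[OF I indW intW] EW by (simp add: n_def)
  have intP: "integrable M (\<lambda>\<omega>. \<Prod>i\<in>I. W i \<omega>)"
    by (rule indep_vars_integrable[OF I indW intW])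
  \<comment> \<open>At \<open>z = 0\<close> also \<open>a = 0\<close>, and \<open>0 powr 0\<close>
    is 0 by convention, so the intended level 1 is set by hand. There the event forces every
    \<open>Y i\<close> to vanish, and the product is exactly 1.\<close>
  define c where "c = (if z = 0 then 1 else a powr (n * z))"
  have c: "0 < c" using a_pos by (auto simp: c_def)
  have ev: "c \<le> (\<Prod>i\<in>I. W i \<omega>)" if w: "\<omega> \<in> space M" "(\<Sum>i\<in>I. Y i \<omega>) \<le> n * z" for \<omega>
  proof (cases "z = 0")
    case True
    have "(\<Sum>i\<in>I. Y i \<omega>) \<le> 0" using w True by simp
    then have "(\<Sum>i\<in>I. Y i \<omega>) = 0" using Y w by (intro antisym sum_nonneg) auto
    then have "Y i \<omega> = 0" if "i \<in> I" for i
      using sum_nonneg_eq_0_iff[OF I, of "\<lambda>i. Y i \<omega>"] Y w that by auto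
    then show ?thesis by (simp add: W_def c_def True)
  next
    case False
    have "c \<le> a powr (\<Sum>i\<in>I. Y i \<omega>)"
      using w False a_pos[OF False] a1 by (simp add: c_def powr_mono')
    also have "\<dots> = (\<Prod>i\<in>I. a powr Y i \<omega>)"
      using a_pos[OF False] I by (simp add: powr_sum)
    also have "\<dots> \<le> (\<Prod>i\<in>I. W i \<omega>)"
      using Y w a_pos[OF False] by (intro prod_mono) (auto simp: W_def powr_le_chord)
    finally show ?thesis .
  qed
  have "prob {\<omega> \<in> space M. (\<Sum>i\<in>I. Y i \<omega>) \<le> n * z} \<le> prob {\<omega> \<in> space M. c \<le> (\<Prod>i\<in>I. W i \<omega>)}"
    using ev borel_measurable_integrable[OF intP] by (intro finite_measure_mono) auto
  also have "\<dots> \<le> ((1 - p) / (1 - z)) ^ n / c"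
    unfolding EP[symmetric] using W0 c
    by (intro integral_Markov_inequality_measure[OF intP sets.empty_sets]) (auto intro!: AE_I2 prod_nonneg)
  also have "\<dots> = exp (n * MB z p)"
  proof (cases "z = 0")
    case True
    then show ?thesis using p by (simp add: MB_def c_def exp_of_nat_mult)
  next
    case False
    have ln_a: "ln a = ln z + ln (1 - p) - (ln (1 - z) + ln p)"
      using False z p by (simp add: a_def ln_div ln_mult)
    have "ln (((1 - p) / (1 - z)) ^ n / c) = n * (ln (1 - p) - ln (1 - z)) - n * z * ln a"
      using False a_pos[OF False] z p by (simp add: c_def ln_div ln_realpow ln_powr)
    also have "\<dots> = n * MB z p"
      using z p by (simp add: ln_a MB_expand algebra_simps)
    finally have "ln (((1 - p) / (1 - z)) ^ n / c) = n * MB z p" .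
    moreover have "0 < ((1 - p) / (1 - z)) ^ n / c" using c z p by simp
    ultimately show ?thesis by (metis exp_ln)
  qed
  finally show ?thesis by (simp add: n_def)
qed

text \<open>The lower-tail bound for \<open>1 - Y i\<close>, with mean \<open>1 - p\<close> and
  level \<open>1 - z\<close>.\<close>

lemma chernoff_unit_ge:
  fixes Y :: "'i \<Rightarrow> 'a \<Rightarrow> real" and p z :: real
  assumes I: "finite I" and ind: "indep_vars (\<lambda>_. borel) Y I"
    and Y: "\<And>i \<omega>. i \<in> I \<Longrightarrow> \<omega> \<in> space M \<Longrightarrow> Y i \<omega> \<in> {0..1}"
    and p: "\<And>i. i \<in> I \<Longrightarrow> expectation (Y i) = p" "0 < p" "p < 1"
    and z: "p \<le> z" "z \<le> 1"
  shows "prob {\<omega> \<in> space M. card I * z \<le> (\<Sum>i\<in>I. Y i \<omega>)} \<le> exp (card I * MB z p)"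
proof -
  have ind': "indep_vars (\<lambda>_. borel) (\<lambda>i \<omega>. 1 - Y i \<omega>) I"
    by (rule indep_vars_compose2[OF ind, of "\<lambda>i y. 1 - y"]) simp
  have rv: "Y i \<in> borel_measurable M" if "i \<in> I" for i
    using ind that by (auto simp: indep_vars_def)
  have "integrable M (Y i)" if "i \<in> I" for i
    using that Y rv by (intro integrable_const_bound[of _ 1]) (auto intro!: AE_I2)
  then have "expectation (\<lambda>\<omega>. 1 - Y i \<omega>) = 1 - p" if "i \<in> I" for i
    using that p by (simp add: prob_space)
  then have "prob {\<omega> \<in> space M. (\<Sum>i\<in>I. 1 - Y i \<omega>) \<le> card I * (1 - z)}
      \<le> exp (card I * MB (1 - z) (1 - p))"
    using Y p z by (intro chernoff_unit_le[OF I ind']) auto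
  then show ?thesis by (simp add: MB_flip sum_subtractf algebra_simps)
qed

section \<open>Values at which the tail probability is small\<close>

text \<open>Let \<open>a\<close> be the infimum of \<open>Z\<close> on the event. If it is attained,
  the event lies in the tail at that outcome. Otherwise the event is the increasing union of its
  parts with \<open>Z \<ge> a + 1 / Suc k\<close>; each part lies in the tail at some outcome of the
  event closer to \<open>a\<close>, and continuity from below gives the bound. \<open>Q\<close> is
  arbitrary, so no monotonicity of the confidence limits in \<open>z\<close> enters.\<close>

lemma prob_le_if_upper_tails_le:
  fixes Z :: "'a \<Rightarrow> real"
  assumes [measurable]: "Z \<in> borel_measurable M"
    and ev[measurable]: "{\<omega> \<in> space M. Q (Z \<omega>)} \<in> events"
    and bdd: "\<And>\<omega>. \<omega> \<in> space M \<Longrightarrow> B \<le> Z \<omega>" and "0 \<le> c"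
    and tail: "\<And>\<omega>. \<omega> \<in> space M \<Longrightarrow> Q (Z \<omega>) \<Longrightarrow> prob {\<omega>' \<in> space M. Z \<omega> \<le> Z \<omega>'} \<le> c"
  shows "prob {\<omega> \<in> space M. Q (Z \<omega>)} \<le> c"
proof -
  define E where "E = {\<omega> \<in> space M. Q (Z \<omega>)}"
  have [measurable]: "E \<in> events" using ev by (simp add: E_def)
  have bd: "bdd_below (Z ` E)" using bdd by (intro bdd_belowI[of _ B]) (auto simp: E_def)
  define a where "a = Inf (Z ` E)"
  have a: "a \<le> Z \<omega>" if "\<omega> \<in> E" for \<omega> unfolding a_def using that bd by (intro cInf_lower) auto
  have sub: "prob F \<le> c" if "F \<subseteq> {\<omega>' \<in> space M. Z \<omega> \<le> Z \<omega>'}" "\<omega> \<in> E" for F \<omega>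
  proof -
    have "prob F \<le> prob {\<omega>' \<in> space M. Z \<omega> \<le> Z \<omega>'}"
      using that by (intro finite_measure_mono) auto
    also have "\<dots> \<le> c" using that tail by (simp add: E_def)
    finally show ?thesis .
  qed
  have "prob E \<le> c"
  proof (cases "a \<in> Z ` E")
    case True
    then obtain w where "w \<in> E" "a = Z w" by auto
    then show ?thesis using a by (intro sub[of E w]) (auto simp: E_def)
  next
    case na: False
    define F where "F k = {\<omega> \<in> E. a + 1 / Suc k \<le> Z \<omega>}" for k :: nat
    have F: "F k \<in> events" for k unfolding F_def by measurable
    have "incseq F"
    proof (intro incseq_SucI subsetI)
      fix k \<omega> assume "\<omega> \<in> F k"
      moreover have "1 / real (Suc (Suc k)) \<le> 1 / real (Suc k)" by (intro divide_left_mono) auto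
      ultimately show "\<omega> \<in> F (Suc k)" unfolding F_def by (auto intro: order_trans)
    qed
    have "(\<Union>k. F k) = E"
    proof (intro equalityI subsetI)
      fix \<omega> assume w: "\<omega> \<in> E"
      then have "a < Z \<omega>" using a[OF w] na by (metis imageI less_le)
      then obtain k where "1 / real (Suc k) < Z \<omega> - a"
        using reals_Archimedean[of "Z \<omega> - a"] by (auto simp: inverse_eq_divide)
      then have "\<omega> \<in> F k" using w by (simp add: F_def)
      then show "\<omega> \<in> (\<Union>k. F k)" by blast
    qed (auto simp: F_def)
    then have lim: "(\<lambda>k. prob (F k)) \<longlonglongrightarrow> prob E"
      using finite_Lim_measure_incseq[of F] F \<open>incseq F\<close> by auto
    have "prob (F k) \<le> c" for k
    proof (cases "E = {}")
      case True
      then show ?thesis using \<open>0 \<le> c\<close> by (simp add: F_def)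
    next
      case False
      then obtain w where "w \<in> E" "Z w < a + 1 / Suc k"
        using cInf_lessD[of "Z ` E" "a + 1 / Suc k"] by (auto simp: a_def)
      then show ?thesis by (intro sub[of _ w]) (auto simp: F_def E_def)
    qed
    then show ?thesis by (intro LIMSEQ_le_const2[OF lim]) auto
  qed
  then show ?thesis by (simp add: E_def)
qed

lemma prob_le_if_lower_tails_le:
  fixes Z :: "'a \<Rightarrow> real"
  assumes "Z \<in> borel_measurable M"
    and "{\<omega> \<in> space M. Q (Z \<omega>)} \<in> events"
    and "\<And>\<omega>. \<omega> \<in> space M \<Longrightarrow> Z \<omega> \<le> B" and "0 \<le> c"
    and "\<And>\<omega>. \<omega> \<in> space M \<Longrightarrow> Q (Z \<omega>) \<Longrightarrow> prob {\<omega>' \<in> space M. Z \<omega>' \<le> Z \<omega>} \<le> c"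
  shows "prob {\<omega> \<in> space M. Q (Z \<omega>)} \<le> c"
  using prob_le_if_upper_tails_le[of "\<lambda>\<omega>. - Z \<omega>" "\<lambda>y. Q (- y)" "- B" c] assms by simp

end

section \<open>Measurability and the coverage probability\<close>

text \<open>The sample number is a \<open>LEAST\<close> over measurable conditions and takes
  countably many values; for each fixed value the quotient is measurable.\<close>

lemma borel_measurable_mu_hat:
  fixes Xs :: "nat \<Rightarrow> 'a \<Rightarrow> real"
  assumes Xs: "\<And>i. 1 \<le> i \<Longrightarrow> Xs i \<in> borel_measurable M"
  shows "(\<lambda>\<omega>. mu_hat \<gamma> n (\<lambda>i. Xs i \<omega>)) \<in> borel_measurable M"
proof -
  have [measurable]: "(\<lambda>\<omega>. \<Sum>i=1..l. Xs i \<omega>) \<in> borel_measurable M" for l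
    using Xs by (intro borel_measurable_sum) auto
  have [measurable]: "(\<lambda>\<omega>. sample_number \<gamma> n (\<lambda>i. Xs i \<omega>)) \<in> measurable M (count_space UNIV)"
    unfolding sample_number_def Inf_nat_def insert_iff mem_Collect_eq by measurable
  have "(\<lambda>\<omega>. min (\<Sum>i=1..l. Xs i \<omega>) \<gamma> / real l) \<in> borel_measurable M" for l
    by measurable
  then show ?thesis
    unfolding mu_hat_def by (rule measurable_compose_countable) measurable
qed

lemma borel_measurable_MB [measurable]: "(\<lambda>z. MB z p) \<in> borel_measurable borel"
  unfolding MB_eq by measurable

lemma borel_measurable_MI [measurable]: "(\<lambda>z. MI z p) \<in> borel_measurable borel"
  unfolding MI_def by measurable

theorem theorem14:
  fixes M :: "'a measure" and X :: "'a \<Rightarrow> real" and Xs :: "nat \<Rightarrow> 'a \<Rightarrow> real"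
    and \<mu> \<gamma> \<delta> :: real and n :: nat
  assumes "prob_space M"
    and "X \<in> borel_measurable M"
    and "\<And>\<omega>. \<omega> \<in> space M \<Longrightarrow> X \<omega> \<in> {0..1}"
    and "\<mu> = prob_space.expectation M X"
    and "0 < \<mu>" and "\<mu> < 1"
    and "prob_space.indep_vars M (\<lambda>_. borel) Xs {1..}"
    and "\<And>i. 1 \<le> i \<Longrightarrow> distr M borel (Xs i) = distr M borel X"
    and "\<And>i \<omega>. 1 \<le> i \<Longrightarrow> \<omega> \<in> space M \<Longrightarrow> Xs i \<omega> \<in> {0..1}"
    and "0 < \<gamma>" and "1 \<le> n"
    and "0 < \<delta>" and "\<delta> < 1"
  shows "prob_space.prob M {\<omega> \<in> space M.
           lower_limit \<gamma> n \<delta> (mu_hat \<gamma> n (\<lambda>i. Xs i \<omega>)) < \<mu> \<and>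
           \<mu> < upper_limit \<gamma> n \<delta> (mu_hat \<gamma> n (\<lambda>i. Xs i \<omega>))} \<ge> 1 - \<delta>"
proof -
  interpret prob_space M by fact
  define Z where "Z \<omega> = mu_hat \<gamma> n (\<lambda>i. Xs i \<omega>)" for \<omega>
  define S where "S l \<omega> = (\<Sum>i=1..l. Xs i \<omega>)" for l \<omega>
  define b where "b = ln (\<delta> / 2)"
  have exp_b: "exp b = \<delta> / 2" using assms by (simp add: b_def)
  have Xs_meas: "Xs i \<in> borel_measurable M" if "1 \<le> i" for i
    using assms(7) that by (auto simp: indep_vars_def)
  have Xs_mean: "expectation (Xs i) = \<mu>" if "1 \<le> i" for i
  proof -
    have "expectation (Xs i) = integral\<^sup>L (distr M borel (Xs i)) (\<lambda>y. y)"
      using Xs_meas[OF that] by (simp add: integral_distr)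
    also have "\<dots> = \<mu>"
      unfolding assms(8)[OF that] using assms(2,4) by (simp add: integral_distr)
    finally show ?thesis .
  qed
  have path: "(\<lambda>i. Xs i \<omega>) \<in> {1..} \<rightarrow> {0..1}" if "\<omega> \<in> space M" for \<omega>
    using assms(9) that by auto
  have [measurable]: "S l \<in> borel_measurable M" for l
    unfolding S_def using Xs_meas by (intro borel_measurable_sum) auto
  have [measurable]: "Z \<in> borel_measurable M"
    unfolding Z_def using Xs_meas by (rule borel_measurable_mu_hat)
  have Z_bounds: "0 \<le> Z \<omega>" "Z \<omega> \<le> 1" if "\<omega> \<in> space M" for \<omega>
    unfolding Z_def using mu_hat_bounds[OF path[OF that] \<open>0 < \<gamma>\<close> \<open>1 \<le> n\<close>] .
  have ind: "indep_vars (\<lambda>_. borel) Xs {1..l}" for l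
    using assms(7) by (rule indep_vars_subset) auto
  have sum_ge: "prob {\<omega> \<in> space M. l * z \<le> S l \<omega>} \<le> exp (l * MB z \<mu>)"
    if "\<mu> \<le> z" "z \<le> 1" for l z
    using chernoff_unit_ge[OF _ ind[of l], of \<mu> z] that assms(5,6,9) Xs_mean by (simp add: S_def)
  have sum_le: "prob {\<omega> \<in> space M. S l \<omega> \<le> l * z} \<le> exp (l * MB z \<mu>)"
    if "0 \<le> z" "z \<le> \<mu>" for l z
    using chernoff_unit_le[OF _ ind[of l], of \<mu> z] that assms(5,6,9) Xs_mean by (simp add: S_def)

  \<comment> \<open>\<open>L\<close> and \<open>U\<close> express failure of the lower and of the
    upper limit without the operator \<open>THE\<close>. In this form the failure events are visibly
    measurable, and the inequalities on \<open>MB\<close> and \<open>MI\<close> feed the Chernoff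
    bounds.\<close>
  define L where "L z \<longleftrightarrow> \<mu> \<le> z \<and>
    (if z < \<gamma> / n then MB z \<mu> \<le> b / n else MI z \<mu> \<le> b / \<gamma>)" for z
  define U where "U z \<longleftrightarrow> z < \<gamma> / (\<gamma> + 1) \<and>
    (if z < \<gamma> / n then z \<le> \<mu> \<and> MB z \<mu> \<le> b / n
     else z * \<gamma> / (\<gamma> - z) \<le> \<mu> \<and> MI (z * \<gamma> / (\<gamma> - z)) \<mu> \<le> b / \<gamma>)" for z
  have L_iff: "\<mu> \<le> lower_limit \<gamma> n \<delta> (Z \<omega>) \<longleftrightarrow> L (Z \<omega>)" if "\<omega> \<in> space M" for \<omega>
    unfolding L_def b_def using Z_bounds[OF that] assms by (intro lower_limit_ge_iff)
  have U_iff: "upper_limit \<gamma> n \<delta> (Z \<omega>) \<le> \<mu> \<longleftrightarrow> U (Z \<omega>)" if "\<omega> \<in> space M" for \<omega>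
    unfolding U_def b_def using Z_bounds[OF that] assms by (intro upper_limit_le_iff)
  have [measurable]: "Measurable.pred borel L" "Measurable.pred borel U"
    unfolding L_def U_def by measurable

  have "prob {\<omega> \<in> space M. L (Z \<omega>)} \<le> \<delta> / 2"
  proof (rule prob_le_if_upper_tails_le[where B = 0])
    fix \<omega> assume \<omega>: "\<omega> \<in> space M" "L (Z \<omega>)"
    \<comment> \<open>The outcome \<open>\<omega>\<close> is fixed, so \<open>Z \<omega>\<close> is
      a constant level and only \<open>\<omega>'\<close> is random.\<close>
    show "prob {\<omega>' \<in> space M. Z \<omega> \<le> Z \<omega>'} \<le> \<delta> / 2"
      using path[OF \<omega>(1)] \<open>0 < \<gamma>\<close> \<open>1 \<le> n\<close>
    proof (cases rule: mu_hat_cases)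
      case truncated
      then have z: "Z \<omega> < \<gamma> / n" by (simp add: Z_def)
      have "{\<omega>' \<in> space M. Z \<omega> \<le> Z \<omega>'} \<subseteq> {\<omega>' \<in> space M. n * Z \<omega> \<le> S n \<omega>'}"
        unfolding Z_def S_def
        using truncated_le_mu_hat[OF path \<open>0 < \<gamma>\<close> \<open>1 \<le> n\<close>] z[unfolded Z_def] by auto
      then have "prob {\<omega>' \<in> space M. Z \<omega> \<le> Z \<omega>'} \<le> prob {\<omega>' \<in> space M. n * Z \<omega> \<le> S n \<omega>'}"
        by (rule finite_measure_mono) measurable
      also have "\<dots> \<le> exp (n * MB (Z \<omega>) \<mu>)"
        using \<omega> Z_bounds by (intro sum_ge) (auto simp: L_def)
      also have "\<dots> \<le> exp b"
        using \<omega> z assms by (simp add: L_def field_simps)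
      finally show ?thesis by (simp add: exp_b)
    next
      case (stopped m)
      then have z: "Z \<omega> = \<gamma> / m" "\<not> Z \<omega> < \<gamma> / n" by (simp_all add: Z_def)
      have "{\<omega>' \<in> space M. Z \<omega> \<le> Z \<omega>'} \<subseteq> {\<omega>' \<in> space M. m * (\<gamma> / m) \<le> S m \<omega>'}"
        unfolding z(1) unfolding Z_def S_def
        using stopped_le_mu_hat[OF path \<open>0 < \<gamma>\<close> \<open>1 \<le> n\<close>] stopped(1,2) by auto
      then have "prob {\<omega>' \<in> space M. Z \<omega> \<le> Z \<omega>'} \<le> prob {\<omega>' \<in> space M. m * (\<gamma> / m) \<le> S m \<omega>'}"
        by (rule finite_measure_mono) measurable
      also have "\<dots> \<le> exp (m * MB (\<gamma> / m) \<mu>)"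
        using \<omega>(2) Z_bounds[OF \<omega>(1)] unfolding z(1)[symmetric]
        by (intro sum_ge) (simp_all add: L_def)
      \<comment> \<open>The factor \<open>1 / z\<close> in \<open>MI\<close> is
        \<open>m / \<gamma>\<close> here; this is why the equation in the stopped regime has
        \<open>\<gamma>\<close> in place of the number of samples.\<close>
      also have "m * MB (\<gamma> / m) \<mu> = \<gamma> * MI (Z \<omega>) \<mu>"
        using stopped(1) assms z(1) by (simp add: MI_def)
      also have "\<dots> \<le> b"
        using \<omega> z(2) assms by (simp add: L_def field_simps)
      finally show ?thesis by (simp add: exp_b)
    qed
  qed (use Z_bounds assms in auto)

  moreover have "prob {\<omega> \<in> space M. U (Z \<omega>)} \<le> \<delta> / 2"
  proof (rule prob_le_if_lower_tails_le[where B = 1])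
    fix \<omega> assume \<omega>: "\<omega> \<in> space M" "U (Z \<omega>)"
    show "prob {\<omega>' \<in> space M. Z \<omega>' \<le> Z \<omega>} \<le> \<delta> / 2"
      using path[OF \<omega>(1)] \<open>0 < \<gamma>\<close> \<open>1 \<le> n\<close>
    proof (cases rule: mu_hat_cases)
      case truncated
      then have z: "Z \<omega> < \<gamma> / n" by (simp add: Z_def)
      have "{\<omega>' \<in> space M. Z \<omega>' \<le> Z \<omega>} \<subseteq> {\<omega>' \<in> space M. S n \<omega>' \<le> n * Z \<omega>}"
        unfolding Z_def S_def
        using mu_hat_le_truncated[OF path \<open>0 < \<gamma>\<close> \<open>1 \<le> n\<close>] z[unfolded Z_def] by auto
      then have "prob {\<omega>' \<in> space M. Z \<omega>' \<le> Z \<omega>} \<le> prob {\<omega>' \<in> space M. S n \<omega>' \<le> n * Z \<omega>}"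
        by (rule finite_measure_mono) measurable
      also have "\<dots> \<le> exp (n * MB (Z \<omega>) \<mu>)"
        using \<omega> Z_bounds z by (intro sum_le) (auto simp: U_def)
      also have "\<dots> \<le> exp b"
        using \<omega> z assms by (simp add: U_def field_simps)
      finally show ?thesis by (simp add: exp_b)
    next
      case (stopped m)
      then have z: "Z \<omega> = \<gamma> / m" "\<not> Z \<omega> < \<gamma> / n" by (simp_all add: Z_def)
      \<comment> \<open>The first condition in \<open>U\<close> excludes the values where the upper
        limit is 1. It yields \<open>m > \<gamma> + 1\<close>, so time \<open>m - 1\<close> is
        positive and larger than \<open>\<gamma>\<close>.\<close>
      have "\<gamma> / m < \<gamma> / (\<gamma> + 1)" using \<omega> z(1) by (simp add: U_def)
      then have "\<gamma> * (\<gamma> + 1) < \<gamma> * m"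
        using stopped(1) assms(10) by (simp add: field_simps)
      then have "\<gamma> + 1 < m" using assms(10) by simp
      then have m: "1 < m" "\<gamma> < real (m - 1)" using assms by linarith+
      \<comment> \<open>The level for the sum at time \<open>m - 1\<close>:
        \<open>(m - 1) * y = \<gamma>\<close>, and \<open>y\<close> is the shifted argument at
        \<open>z = \<gamma> / m\<close>.\<close>
      define y where "y = \<gamma> / real (m - 1)"
      have my: "real (m - 1) * y = \<gamma>" using m by (simp add: y_def)
      have "\<gamma> / m * \<gamma> / (\<gamma> - \<gamma> / m) = y"
        using m assms by (simp add: y_def field_simps of_nat_diff)
      then have y: "0 < y" "y \<le> \<mu>" "MI y \<mu> \<le> b / \<gamma>"
        using \<omega> z m assms by (auto simp: U_def y_def)
      have "{\<omega>' \<in> space M. Z \<omega>' \<le> Z \<omega>} \<subseteq> {\<omega>' \<in> space M. S (m - 1) \<omega>' \<le> real (m - 1) * y}"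
        unfolding z(1) my unfolding Z_def S_def
        using mu_hat_le_stopped[OF path \<open>0 < \<gamma>\<close> \<open>1 \<le> n\<close> m(1) stopped(2)] by auto
      then have "prob {\<omega>' \<in> space M. Z \<omega>' \<le> Z \<omega>}
          \<le> prob {\<omega>' \<in> space M. S (m - 1) \<omega>' \<le> real (m - 1) * y}"
        by (rule finite_measure_mono) measurable
      also have "\<dots> \<le> exp (real (m - 1) * MB y \<mu>)"
        using y by (intro sum_le) auto
      also have "real (m - 1) * MB y \<mu> = \<gamma> * MI y \<mu>"
        using y(1) by (simp add: MI_def my[symmetric])
      also have "\<dots> \<le> b"
        using y(3) assms by (simp add: field_simps)
      finally show ?thesis by (simp add: exp_b)
    qed
  qed (use Z_bounds assms in auto)

  moreover have "prob {\<omega> \<in> space M. L (Z \<omega>) \<or> U (Z \<omega>)}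
      \<le> prob {\<omega> \<in> space M. L (Z \<omega>)} + prob {\<omega> \<in> space M. U (Z \<omega>)}"
  proof -
    have "{\<omega> \<in> space M. L (Z \<omega>) \<or> U (Z \<omega>)} =
        {\<omega> \<in> space M. L (Z \<omega>)} \<union> {\<omega> \<in> space M. U (Z \<omega>)}" by auto
    then show ?thesis by (simp only:) (intro measure_Un_le; measurable)
  qed
  ultimately have "1 - \<delta> \<le> 1 - prob {\<omega> \<in> space M. L (Z \<omega>) \<or> U (Z \<omega>)}" by simp
  also have "\<dots> = prob {\<omega> \<in> space M. \<not> (L (Z \<omega>) \<or> U (Z \<omega>))}"
    by (subst prob_neg) simp_all
  also have "{\<omega> \<in> space M. \<not> (L (Z \<omega>) \<or> U (Z \<omega>))} = {\<omega> \<in> space M.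
      lower_limit \<gamma> n \<delta> (Z \<omega>) < \<mu> \<and> \<mu> < upper_limit \<gamma> n \<delta> (Z \<omega>)}"
    using L_iff U_iff by (auto simp: not_le[symmetric])
  finally show ?thesis by (simp add: Z_def)
qed

end
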